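(* Let $K$ be a field of characteristic zero, let $\mathfrak{g}=(V,[\,,])$ be a Lie algebra over $K$, and let $(V,\cdot)$ be a CPA-structure on $\mathfrak{g}$. Then $(V,\cdot,[\,,])$ is a Poisson algebra if and only if $(V,\cdot)$ is central, i.e. $\mathfrak{g}\cdot\mathfrak{g}\subseteq Z(\mathfrak{g})$.
   Context: A commutative post-Lie algebra structure (CPA-structure) on a Lie algebra $\mathfrak{g}=(V,[\,,])$ over $K$ is a $K$-bilinear product $x\cdot y$ on $V$ such that for all $x,y,z\in V$: $x\cdot y=y\cdot x$; $[x,y]\cdot z=x\cdot(y\cdot z)-y\cdot(x\cdot z)$; $x\cdot[y,z]=[x\cdot y,z]+[y,x\cdot z]$. A Poisson algebra is a triple $(V,\circ,[\,,])$ where $(V,\circ)$ is a commutative associative algebra, $(V,[\,,])$ is a Lie algebra, and $[x,y\circ z]=[x,y]\circ z+y\circ[x,z]$ for all $x,y,z\in V$. $Z(\mathfrak{g})$ denotes the center of $\mathfrak{g}$. *)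

theory Defs
  imports Complex_Main
begin

text \<open>
  The field \<open>K\<close> and the underlying space \<open>V\<close> are rendered as types; no dimension
  restriction is imposed on \<open>V\<close>.  All products are plain binary operations on \<open>V\<close>.
\<close>

locale bilinear_product = vector_space scale
  for scale :: "'k::field \<Rightarrow> 'v::ab_group_add \<Rightarrow> 'v" +
  fixes mul :: "'v \<Rightarrow> 'v \<Rightarrow> 'v"
  assumes linear_right: "\<And>x. Vector_Spaces.linear scale scale (\<lambda>y. mul x y)"
    and linear_left: "\<And>y. Vector_Spaces.linear scale scale (\<lambda>x. mul x y)"

locale lie_algebra = bilinear_product scale bracket
  for scale :: "'k::field \<Rightarrow> 'v::ab_group_add \<Rightarrow> 'v"
    and bracket :: "'v \<Rightarrow> 'v \<Rightarrow> 'v" +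
  assumes alternating: "\<And>x. bracket x x = 0"
    and jacobi:
      "\<And>x y z. bracket x (bracket y z) + bracket y (bracket z x) + bracket z (bracket x y) = 0"

locale cpa_structure = lie_algebra scale bracket + mul: bilinear_product scale mul
  for scale :: "'k::field \<Rightarrow> 'v::ab_group_add \<Rightarrow> 'v"
    and bracket :: "'v \<Rightarrow> 'v \<Rightarrow> 'v"
    and mul :: "'v \<Rightarrow> 'v \<Rightarrow> 'v" +
  assumes mul_commute: "\<And>x y. mul x y = mul y x"
    and bracket_mul: "\<And>x y z. mul (bracket x y) z = mul x (mul y z) - mul y (mul x z)"
    and mul_bracket: "\<And>x y z. mul x (bracket y z) = bracket (mul x y) z + bracket y (mul x z)"

text \<open>Algebras are not required to have a unit.\<close>

locale commutative_associative_algebra = bilinear_product scale mul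
  for scale :: "'k::field \<Rightarrow> 'v::ab_group_add \<Rightarrow> 'v"
    and mul :: "'v \<Rightarrow> 'v \<Rightarrow> 'v" +
  assumes commutative: "\<And>x y. mul x y = mul y x"
    and associative: "\<And>x y z. mul (mul x y) z = mul x (mul y z)"

locale poisson_algebra =
  commutative_associative_algebra scale mul + lie: lie_algebra scale bracket
  for scale :: "'k::field \<Rightarrow> 'v::ab_group_add \<Rightarrow> 'v"
    and mul :: "'v \<Rightarrow> 'v \<Rightarrow> 'v"
    and bracket :: "'v \<Rightarrow> 'v \<Rightarrow> 'v" +
  assumes leibniz: "\<And>x y z. bracket x (mul y z) = mul (bracket x y) z + mul y (bracket x z)"

definition lie_center :: "('v::zero \<Rightarrow> 'v \<Rightarrow> 'v) \<Rightarrow> 'v set"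
  where "lie_center bracket = {z. \<forall>x. bracket x z = 0}"

text \<open>As usual, \<open>A \<cdot> B\<close> for subspaces is the linear span of the products, not just their set.\<close>

definition product_space ::
  "('k::field \<Rightarrow> 'v::ab_group_add \<Rightarrow> 'v) \<Rightarrow> ('v \<Rightarrow> 'v \<Rightarrow> 'v) \<Rightarrow> 'v set \<Rightarrow> 'v set \<Rightarrow> 'v set"
  where "product_space scale mul A B = module.span scale {mul x y | x y. x \<in> A \<and> y \<in> B}"

definition central_cpa ::
  "('k::field \<Rightarrow> 'v::ab_group_add \<Rightarrow> 'v) \<Rightarrow> ('v \<Rightarrow> 'v \<Rightarrow> 'v) \<Rightarrow> ('v \<Rightarrow> 'v \<Rightarrow> 'v) \<Rightarrow> bool"
  where "central_cpa scale bracket mul \<longleftrightarrow>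
    product_space scale mul UNIV UNIV \<subseteq> lie_center bracket"

end

theory Submission
  imports Defs
begin

text \<open>
  Both conditions force \<open>[x, y] \<cdot> z = 0\<close>: associativity does so through the CPA identity for
  \<open>[x, y] \<cdot> z\<close>, and centrality through the one for \<open>x \<cdot> [y, z]\<close>. Given this vanishing, left
  multiplications commute, which for a commutative product is associativity, and the Leibniz
  rule reduces to \<open>[x, y \<cdot> z] = 0\<close>, which is centrality.
\<close>

context bilinear_product
begin

lemmas module_hom_right = Vector_Spaces.linear.axioms(3)[OF linear_right]
lemmas module_hom_left = Vector_Spaces.linear.axioms(3)[OF linear_left]

end

text \<open>The kernel of the linear map \<open>bracket x\<close> is a subspace, so vanishing on all
  products extends to their span.\<close>

lemma (in cpa_structure) central_cpa_iff:
  "central_cpa scale bracket mul \<longleftrightarrow> (\<forall>x y z. bracket x (mul y z) = 0)"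
proof
  assume "central_cpa scale bracket mul"
  moreover have "mul y z \<in> product_space scale mul UNIV UNIV" for y z
    unfolding product_space_def by (rule span_base) blast
  ultimately show "\<forall>x y z. bracket x (mul y z) = 0"
    unfolding central_cpa_def lie_center_def by blast
next
  assume zero: "\<forall>x y z. bracket x (mul y z) = 0"
  have "bracket x w = 0" if "w \<in> product_space scale mul UNIV UNIV" for x w
    by (rule module_hom.eq_0_on_span[OF module_hom_right _ that[unfolded product_space_def]])
      (use zero in auto)
  then show "central_cpa scale bracket mul"
    unfolding central_cpa_def lie_center_def by blast
qed

lemma (in lie_algebra) bracket_antisym: "bracket x y = - bracket y x"
proof -
  have "bracket (x + y) (x + y) = bracket x x + bracket x y + (bracket y x + bracket y y)"
    by (simp only: module_hom.add[OF module_hom_right] module_hom.add[OF module_hom_left] add_ac)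
  then show ?thesis
    by (simp add: alternating eq_neg_iff_add_eq_0)
qed

theorem lemma2p9:
  fixes scale :: "'k::field_char_0 \<Rightarrow> 'v::ab_group_add \<Rightarrow> 'v"
    and bracket :: "'v \<Rightarrow> 'v \<Rightarrow> 'v"
    and mul :: "'v \<Rightarrow> 'v \<Rightarrow> 'v"
  assumes "lie_algebra scale bracket"
    and "cpa_structure scale bracket mul"
  shows "poisson_algebra scale mul bracket \<longleftrightarrow> central_cpa scale bracket mul"
proof -
  interpret cpa_structure scale bracket mul by fact
  show ?thesis
  proof
    assume "poisson_algebra scale mul bracket"
    then interpret P: poisson_algebra scale mul bracket .
    \<comment> \<open>Associativity rewrites the right side of \<open>bracket_mul\<close> as
      \<open>mul (mul x y) z - mul (mul y x) z\<close>, which cancels by commutativity.\<close>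
    have "mul (bracket x y) z = 0" for x y z
      unfolding bracket_mul P.associative[symmetric] mul_commute[of y x] by simp
    then have "bracket x (mul y z) = 0" for x y z
      unfolding P.leibniz mul_commute[of y "bracket x z"] by simp
    then show "central_cpa scale bracket mul"
      by (simp add: central_cpa_iff)
  next
    assume "central_cpa scale bracket mul"
    then have central: "bracket x (mul y z) = 0" for x y z
      by (simp add: central_cpa_iff)
    \<comment> \<open>Both summands of \<open>mul_bracket\<close> vanish; the first has its product
      in the left slot of the bracket, hence the antisymmetry.\<close>
    have zero: "mul x (bracket y z) = 0" for x y z
      using central bracket_antisym[of "mul x y" z] by (simp add: mul_bracket)
    then have zero': "mul (bracket x y) z = 0" for x y z
      by (subst mul_commute)
    have "mul x (mul y z) = mul y (mul x z)" for x y z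
      using bracket_mul[of x y z] zero'[of x y z] by simp
    \<comment> \<open>Commutativity turns the goal into
      \<open>mul z (mul x y) = mul x (mul z y)\<close>, so left multiplications by \<open>z\<close>
      and \<open>x\<close> are the ones that commute here.\<close>
    then have assoc: "mul (mul x y) z = mul x (mul y z)" for x y z
      unfolding mul_commute[of "mul x y" z] mul_commute[of y z] .
    show "poisson_algebra scale mul bracket"
      by unfold_locales (fact mul_commute, fact assoc, simp add: central zero zero')
  qed
qed

end
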